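(* For every integer $n\ge1$, $c(n,2)=2(2^n-1)$.
   Context: For integers $n\ge1$, $k\ge0$, $c(n,k)$ denotes the least integer such that for every $m$, every matrix $A\in\mathbb{R}^{m\times n}$ and every $b\in\mathbb{R}^m$: if the polyhedron $\{x\in\mathbb{R}^n : Ax\le b\}$ contains exactly $k$ integer points (points of $\mathbb{Z}^n$), then there is a subset $I$ of the rows of $A$ with $|I|\le c(n,k)$ such that $\{x\in\mathbb{R}^n : A_Ix\le b_I\}$ contains exactly the same $k$ integer points, where $A_I,b_I$ are the restrictions to the rows in $I$. *)

theory Defs
  imports Complex_Main "Jordan_Normal_Form.Matrix" "Jordan_Normal_Form.DL_Submatrix"
begin

definition polyhedron :: "real mat \<Rightarrow> real vec \<Rightarrow> real vec set" where
  "polyhedron A b = {x \<in> carrier_vec (dim_col A). A *\<^sub>v x \<le> b}"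

definition integer_points :: "real vec set \<Rightarrow> real vec set" where
  "integer_points P = {x \<in> P. \<forall>j < dim_vec x. x $ j \<in> \<int>}"

(* The restriction A_I is the library's submatrix A I UNIV. Here pick I i is the
   i-th smallest element of I, so that b_I is ordered compatibly with A_I. *)
definition subvec :: "'a vec \<Rightarrow> nat set \<Rightarrow> 'a vec" where
  "subvec b I = vec (card {i. i < dim_vec b \<and> i \<in> I}) (\<lambda>i. b $ pick I i)"

(* Rows are counted by their indices, so equal rows at different positions are distinct.
   The finiteness premise matters only for k = 0, since infinite sets have card 0. *)
definition suffices :: "nat \<Rightarrow> nat \<Rightarrow> nat \<Rightarrow> bool" where
  "suffices n k t \<longleftrightarrow>
     (\<forall>m. \<forall>A \<in> carrier_mat m n. \<forall>b \<in> carrier_vec m.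
        finite (integer_points (polyhedron A b)) \<and> card (integer_points (polyhedron A b)) = k \<longrightarrow>
        (\<exists>I \<subseteq> {..<m}. card I \<le> t \<and>
           integer_points (polyhedron (submatrix A I UNIV) (subvec b I)) =
           integer_points (polyhedron A b)))"

(* The number c(n,k). For n \<ge> 1 every k is attained by some polyhedron, so no negative
   integer suffices and the least integer is the least natural number. *)
definition doignon_number :: "nat \<Rightarrow> nat \<Rightarrow> nat" where
  "doignon_number n k = (LEAST t. suffices n k t)"

lemma polyhedron_restrict:
  assumes A: "A \<in> carrier_mat m n" and b: "b \<in> carrier_vec m" and I: "I \<subseteq> {..<m}"
  shows "polyhedron (submatrix A I UNIV) (subvec b I) =
         {x \<in> carrier_vec n. \<forall>i \<in> I. row A i \<bullet> x \<le> b $ i}"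
proof -
  have fin: "finite I"
    using I finite_subset by blast
  have eqI: "{i. i < m \<and> i \<in> I} = I"
    using I by auto
  have dims: "dim_row A = m" "dim_col A = n" "dim_vec b = m"
    using A b by auto
  have drow: "dim_row (submatrix A I UNIV) = card I"
    and dcol: "dim_col (submatrix A I UNIV) = n"
    and dvec: "dim_vec (subvec b I) = card I"
    by (simp_all add: dim_submatrix subvec_def dims eqI)
  have pickI: "pick I i \<in> I" if "i < card I" for i
    using that by (rule pick_in_set_le)
  have rows: "row (submatrix A I UNIV) i = row A (pick I i)" if i: "i < card I" for i
  proof (rule eq_vecI)
    fix j assume "j < dim_vec (row A (pick I i))"
    then have j: "j < n" by (simp add: dims)
    have "pick I i < m" using pickI[OF i] I by auto
    then show "row (submatrix A I UNIV) i $ j = row A (pick I i) $ j"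
      using i j drow dcol submatrix_index[of i A I j UNIV]
      by (simp add: dims eqI pick_UNIV)
  qed (simp add: dims dcol)
  have "(submatrix A I UNIV *\<^sub>v x \<le> subvec b I) \<longleftrightarrow> (\<forall>i \<in> I. row A i \<bullet> x \<le> b $ i)" for x
  proof -
    have "(submatrix A I UNIV *\<^sub>v x \<le> subvec b I) \<longleftrightarrow>
          (\<forall>i < card I. row A (pick I i) \<bullet> x \<le> b $ pick I i)"
      unfolding less_eq_vec_def using rows
      by (auto simp: drow dvec subvec_def dims eqI)
    also have "\<dots> \<longleftrightarrow> (\<forall>i \<in> I. row A i \<bullet> x \<le> b $ i)"
    proof (intro iffI ballI)
      fix i assume *: "\<forall>i < card I. row A (pick I i) \<bullet> x \<le> b $ pick I i" and i: "i \<in> I"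
      have "{a \<in> I. a < i} \<subset> I" using i by auto
      then have "card {a \<in> I. a < i} < card I" by (rule psubset_card_mono[OF fin])
      then show "row A i \<bullet> x \<le> b $ i"
        using * pick_card_in_set[OF i] by metis
    qed (use pickI in auto)
    finally show ?thesis .
  qed
  then show ?thesis
    by (simp add: polyhedron_def dcol)
qed

end

theory Submission
  imports Defs
begin

text \<open>
  Upper bound. Keep a minimal set of rows that still isolates the two integer points p and q.
  Every row is then the only one to cut off some integer point. Push the rows outwards as far as
  possible without letting a third integer point into the open region (lemma push_out_constraints):
  each row now carries an integer point on its own boundary that lies strictly inside all the other
  rows. The midpoint of two such boundary points of the same parity class modulo 2 is an integer
  point of the open region, hence p or q. As a point has only one reflection in p and one in q, a
  parity class contains at most two boundary points. In the class of p the only possible boundary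
  point is 2q - p, since its midpoint with p must be q; likewise for q. The classes of p and q differ,
  as otherwise their own midpoint would be a third integer point. Therefore there are at most
  2(2^n - 2) + 2 rows (lemma card_le_by_parity).

  Lower bound. It suffices to give rows and equally many integer points such that each row cuts off
  exactly its own point and precisely two integer points satisfy all rows (lemma
  card_le_if_suffices). Write n = d + 1 and take 0 and the last unit vector e as the two
  surviving points. Equality in the parity count dictates the pattern: two points in each of the
  other classes, and the points 2e and -e. The points used here are the nonzero vectors of
  {0,1}^n with e replaced by 2e, together with the images of all of these under x \<mapsto> e - x. Each is a
  vertex of their convex hull, and a row is a supporting linear form of that hull at its vertex,
  moved inwards by one. The second half of the rows is the reflection of the first.
\<close>

section \<open>Integer points of a polyhedron and of its subsystems\<close>

definition integer_vecs :: "nat \<Rightarrow> real vec set" where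
  "integer_vecs n = {x \<in> carrier_vec n. \<forall>j < n. x $ j \<in> \<int>}"

lemma integer_points_polyhedron:
  assumes A: "A \<in> carrier_mat m n" and b: "b \<in> carrier_vec m"
  shows "integer_points (polyhedron A b) = {x \<in> integer_vecs n. \<forall>i<m. row A i \<bullet> x \<le> b $ i}"
  using A b
  by (auto simp: integer_points_def polyhedron_def integer_vecs_def less_eq_vec_def)

lemma integer_points_restrict:
  assumes A: "A \<in> carrier_mat m n" and b: "b \<in> carrier_vec m" and I: "I \<subseteq> {..<m}"
  shows "integer_points (polyhedron (submatrix A I UNIV) (subvec b I)) =
         {x \<in> integer_vecs n. \<forall>i\<in>I. row A i \<bullet> x \<le> b $ i}"
  unfolding polyhedron_restrict[OF assms] by (auto simp: integer_points_def integer_vecs_def)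

section \<open>Pushing essential constraints outwards\<close>

text \<open>
  Only finitely many thresholds matter, namely values of the constraints on F. Among all threshold
  vectors that exceed b and admit no new point of F strictly below them, choose one with maximal
  sum. If no admissible point lay on the boundary of some constraint i, its threshold could be
  raised to the smallest value of that constraint at a point strictly inside all the others,
  contradicting maximality; such a point exists because i is essential. Moving all thresholds at once
  avoids a sequential choice in which later steps would have to preserve earlier boundary points.
\<close>

lemma push_out_constraints:
  fixes f :: "'i \<Rightarrow> 'a \<Rightarrow> real"
  assumes finI: "finite I" and finF: "finite F"
    and ess: "\<And>i. i \<in> I \<Longrightarrow> \<exists>x\<in>F. b i < f i x \<and> (\<forall>j\<in>I - {i}. f j x \<le> b j)"
  obtains z where "\<And>i. i \<in> I \<Longrightarrow> z i \<in> F" "\<And>i. i \<in> I \<Longrightarrow> b i < f i (z i)"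
    "\<And>i j. i \<in> I \<Longrightarrow> j \<in> I \<Longrightarrow> i \<noteq> j \<Longrightarrow> f j (z i) < f j (z j)"
    "\<And>x. x \<in> F \<Longrightarrow> \<forall>i\<in>I. f i x < f i (z i) \<Longrightarrow> \<forall>i\<in>I. f i x \<le> b i"
proof -
  define ok where "ok \<beta> \<longleftrightarrow> (\<forall>i\<in>I. b i < \<beta> i) \<and>
      (\<forall>x\<in>F. (\<forall>i\<in>I. f i x < \<beta> i) \<longrightarrow> (\<forall>i\<in>I. f i x \<le> b i))" for \<beta>
  define C where "C = {\<beta> \<in> PiE I (\<lambda>i. f i ` F). ok \<beta>}"
  have finC: "finite C"
    by (rule finite_subset[OF _ finite_PiE[OF finI, of "\<lambda>i. f i ` F"]]) (use finF in \<open>auto simp: C_def\<close>)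
  have "C \<noteq> {}"
  proof -
    \<comment> \<open>A first admissible choice: the smallest value at which a constraint is violated.\<close>
    define V where "V i = f i ` {x\<in>F. b i < f i x}" for i
    have finV: "finite (V i)" for i unfolding V_def using finF by auto
    have V: "Min (V i) \<in> V i" if "i \<in> I" for i
      using ess[OF that] finV by (intro Min_in) (auto simp: V_def)
    have "f i x \<le> b i" if "i \<in> I" "x \<in> F" "f i x < Min (V i)" for i x
    proof (rule ccontr)
      assume "\<not> f i x \<le> b i"
      then have "Min (V i) \<le> f i x"
        using finV that by (intro Min_le) (auto simp: V_def)
      with that show False by simp
    qed
    moreover have "Min (V i) \<in> f i ` F" "b i < Min (V i)" if "i \<in> I" for i
      using V[OF that] unfolding V_def by auto
    ultimately have "restrict (\<lambda>i. Min (V i)) I \<in> C"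
      unfolding C_def ok_def by (auto intro!: restrict_PiE)
    then show ?thesis by blast
  qed
  with finC obtain \<beta> where \<beta>: "\<beta> \<in> C" and Max: "Max ((\<lambda>\<gamma>. sum \<gamma> I) ` C) = sum \<beta> I"
    by (rule obtains_MAX)
  have mx: "sum \<gamma> I \<le> sum \<beta> I" if "\<gamma> \<in> C" for \<gamma>
    unfolding Max[symmetric] using finC that by (intro Max_ge) auto
  have \<beta>ok: "ok \<beta>" and \<beta>P: "\<beta> \<in> PiE I (\<lambda>i. f i ` F)" using \<beta> by (auto simp: C_def)
  have \<beta>_gt: "b i < \<beta> i" if "i \<in> I" for i
    using \<beta>ok that by (simp add: ok_def)
  have \<beta>_inner: "f i x \<le> b i" if "x \<in> F" "\<And>j. j \<in> I \<Longrightarrow> f j x < \<beta> j" "i \<in> I" for i x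
    using \<beta>ok that by (simp add: ok_def)
  have "\<exists>w\<in>F. f i w = \<beta> i \<and> (\<forall>j\<in>I - {i}. f j w < \<beta> j)" if i: "i \<in> I" for i
  proof -
    \<comment> \<open>The points that would enter the open region if constraint i were dropped.\<close>
    define T where "T = {w\<in>F. \<beta> i \<le> f i w \<and> (\<forall>j\<in>I - {i}. f j w < \<beta> j)}"
    have "T \<noteq> {}"
    proof -
      obtain x where x: "x \<in> F" "b i < f i x" "\<forall>j\<in>I - {i}. f j x \<le> b j"
        using ess[OF i] by blast
      have lt: "\<forall>j\<in>I - {i}. f j x < \<beta> j"
      proof
        fix j assume j: "j \<in> I - {i}"
        then have "b j < \<beta> j" by (intro \<beta>_gt) simp
        then show "f j x < \<beta> j" using bspec[OF x(3) j] by linarith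
      qed
      have "\<beta> i \<le> f i x"
      proof (rule ccontr)
        assume "\<not> \<beta> i \<le> f i x"
        then have "f j x < \<beta> j" if "j \<in> I" for j using lt that by (cases "j = i") auto
        then have "f i x \<le> b i" using \<beta>_inner[OF x(1) _ i] by blast
        with x(2) show False by simp
      qed
      then have "x \<in> T" using x(1) lt unfolding T_def by blast
      then show ?thesis by blast
    qed
    have finT: "finite T" using finF by (simp add: T_def)
    obtain w where w: "w \<in> T" and Min: "Min (f i ` T) = f i w"
      using finT \<open>T \<noteq> {}\<close> by (rule obtains_MIN)
    have mn: "f i w \<le> f i v" if "v \<in> T" for v
      unfolding Min[symmetric] using finT that by (intro Min_le) auto
    have "f i w = \<beta> i"
    proof (rule ccontr)
      assume "f i w \<noteq> \<beta> i"
      then have gt: "\<beta> i < f i w" using w by (auto simp: T_def)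
      define \<gamma> where "\<gamma> = \<beta>(i := f i w)"
      have "\<gamma> \<in> PiE I (\<lambda>i. f i ` F)"
        using \<beta>P i w unfolding \<gamma>_def T_def by (auto simp: PiE_iff extensional_def)
      moreover have "ok \<gamma>" unfolding ok_def
      proof (intro conjI ballI impI)
        fix j assume "j \<in> I"
        then have "b j < \<beta> j" by (rule \<beta>_gt)
        then show "b j < \<gamma> j" using gt by (auto simp: \<gamma>_def)
      next
        fix x j assume x: "x \<in> F" "\<forall>j\<in>I. f j x < \<gamma> j" and j: "j \<in> I"
        have lt: "\<forall>j\<in>I - {i}. f j x < \<beta> j" "f i x < f i w"
          using x i by (auto simp: \<gamma>_def split: if_splits)
        have "x \<notin> T" using mn[of x] lt(2) by linarith
        then have "\<not> \<beta> i \<le> f i x" using lt(1) x(1) unfolding T_def by blast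
        then have "f j x < \<beta> j" if "j \<in> I" for j using lt(1) that by (cases "j = i") auto
        then show "f j x \<le> b j" using \<beta>_inner[OF x(1) _ j] by blast
      qed
      ultimately have "sum \<gamma> I \<le> sum \<beta> I" using mx by (simp add: C_def)
      moreover have "sum \<beta> I < sum \<gamma> I"
        using gt i finI by (intro sum_strict_mono_ex1) (auto simp: \<gamma>_def)
      ultimately show False by simp
    qed
    then show ?thesis using w by (auto simp: T_def)
  qed
  then obtain z where z: "\<And>i. i \<in> I \<Longrightarrow> z i \<in> F \<and> f i (z i) = \<beta> i \<and> (\<forall>j\<in>I - {i}. f j (z i) < \<beta> j)"
    by metis
  show thesis
  proof (rule that[of z])
    show "\<forall>i\<in>I. f i x \<le> b i" if "x \<in> F" "\<forall>i\<in>I. f i x < f i (z i)" for x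
      using \<beta>_inner[OF that(1)] that(2) z by simp
  qed (use z \<beta>_gt in auto)
qed

section \<open>Midpoints and parity classes\<close>

definition midpoint_vec :: "real vec \<Rightarrow> real vec \<Rightarrow> real vec" where
  "midpoint_vec x y = (1 / 2) \<cdot>\<^sub>v (x + y)"

definition parity_class :: "nat \<Rightarrow> real vec \<Rightarrow> nat set" where
  "parity_class n x = {j. j < n \<and> odd \<lfloor>x $ j\<rfloor>}"

lemma midpoint_vec_carrier [simp]:
  "x \<in> carrier_vec n \<Longrightarrow> y \<in> carrier_vec n \<Longrightarrow> midpoint_vec x y \<in> carrier_vec n"
  by (simp add: midpoint_vec_def)

lemma midpoint_vec_index:
  "x \<in> carrier_vec n \<Longrightarrow> y \<in> carrier_vec n \<Longrightarrow> j < n \<Longrightarrow> midpoint_vec x y $ j = (x $ j + y $ j) / 2"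
  by (simp add: midpoint_vec_def)

lemma scalar_prod_midpoint_vec:
  "a \<in> carrier_vec n \<Longrightarrow> x \<in> carrier_vec n \<Longrightarrow> y \<in> carrier_vec n \<Longrightarrow>
    a \<bullet> midpoint_vec x y = (a \<bullet> x + a \<bullet> y) / 2"
  by (simp add: midpoint_vec_def scalar_prod_add_distrib[of _ n])

lemma midpoint_vec_cancel:
  assumes "x \<in> carrier_vec n" "y \<in> carrier_vec n" "y' \<in> carrier_vec n"
    and eq: "midpoint_vec x y = midpoint_vec x y'"
  shows "y = y'"
proof (rule eq_vecI)
  fix j assume "j < dim_vec y'"
  then have "j < n" using assms by simp
  moreover have "midpoint_vec x y $ j = midpoint_vec x y' $ j" using eq by simp
  ultimately show "y $ j = y' $ j"
    using assms(1-3) by (simp add: midpoint_vec_index)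
qed (use assms in auto)

lemma midpoint_vec_commute:
  "x \<in> carrier_vec n \<Longrightarrow> y \<in> carrier_vec n \<Longrightarrow> midpoint_vec x y = midpoint_vec y x"
  by (simp add: midpoint_vec_def comm_add_vec[of _ n])

lemma midpoint_vec_same: "x \<in> carrier_vec n \<Longrightarrow> midpoint_vec x x = x"
  by (rule eq_vecI) (auto simp: midpoint_vec_def)

lemma midpoint_vec_integer:
  assumes x: "x \<in> integer_vecs n" and y: "y \<in> integer_vecs n"
    and par: "parity_class n x = parity_class n y"
  shows "midpoint_vec x y \<in> integer_vecs n"
proof -
  have "midpoint_vec x y $ j \<in> \<int>" if j: "j < n" for j
  proof -
    have "x $ j \<in> \<int>" "y $ j \<in> \<int>" using x y j by (auto simp: integer_vecs_def)
    then obtain k l where kl: "x $ j = of_int k" "y $ j = of_int l" by (metis Ints_cases)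
    have "odd k \<longleftrightarrow> odd l"
      using par j kl unfolding parity_class_def set_eq_iff by (metis (mono_tags) floor_of_int mem_Collect_eq)
    then obtain r where "k + l = 2 * r" by (metis dvdE odd_add)
    then have "midpoint_vec x y $ j = of_int r"
      using x y j kl by (simp add: integer_vecs_def midpoint_vec_index[of _ n] flip: of_int_add)
    then show ?thesis by simp
  qed
  then show ?thesis using x y by (auto simp: integer_vecs_def)
qed

text \<open>
  The region left by some of the rows may be unbounded and contain infinitely many integer points.
  Boxes provide finite sets of integer points that are still closed under midpoints of points of
  equal parity, so the whole argument can be carried out inside one of them.
\<close>
definition integer_box :: "nat \<Rightarrow> real \<Rightarrow> real vec set" where
  "integer_box n B = {x \<in> integer_vecs n. \<forall>j<n. \<bar>x $ j\<bar> \<le> B}"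

lemma finite_integer_box: "finite (integer_box n B)"
proof (rule finite_subset)
  show "integer_box n B \<subseteq> (\<lambda>g. vec n (\<lambda>j. of_int (g j))) ` PiE {..<n} (\<lambda>_. {-\<lceil>B\<rceil>..\<lceil>B\<rceil>})"
  proof
    fix x assume x: "x \<in> integer_box n B"
    define g where "g = restrict (\<lambda>j. \<lfloor>x $ j\<rfloor>) {..<n}"
    have int: "of_int \<lfloor>x $ j\<rfloor> = x $ j" if "j < n" for j
      using x that by (auto simp: integer_box_def integer_vecs_def elim!: Ints_cases)
    have "g \<in> PiE {..<n} (\<lambda>_. {-\<lceil>B\<rceil>..\<lceil>B\<rceil>})"
    proof -
      have "-\<lceil>B\<rceil> \<le> \<lfloor>x $ j\<rfloor> \<and> \<lfloor>x $ j\<rfloor> \<le> \<lceil>B\<rceil>" if j: "j < n" for j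
      proof -
        have "\<bar>x $ j\<bar> \<le> B" using x j by (simp add: integer_box_def)
        then have "real_of_int \<bar>\<lfloor>x $ j\<rfloor>\<bar> \<le> of_int \<lceil>B\<rceil>"
          using int[OF j] le_of_int_ceiling[of B] by linarith
        then show ?thesis by linarith
      qed
      then show ?thesis by (auto simp: g_def)
    qed
    moreover have "x = vec n (\<lambda>j. of_int (g j))"
      using x int by (intro eq_vecI) (auto simp: g_def integer_box_def integer_vecs_def)
    ultimately show "x \<in> (\<lambda>g. vec n (\<lambda>j. of_int (g j))) ` PiE {..<n} (\<lambda>_. {-\<lceil>B\<rceil>..\<lceil>B\<rceil>})"
      by blast
  qed
qed (auto intro: finite_PiE)

lemma finite_subset_integer_box:
  assumes "finite Y" "Y \<subseteq> integer_vecs n"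
  obtains B where "Y \<subseteq> integer_box n B"
proof -
  have "finite ((\<lambda>(x, j). \<bar>x $ j\<bar>) ` (Y \<times> {..<n}))" using assms by auto
  from bdd_above_finite[OF this] obtain B where "\<And>x j. x \<in> Y \<Longrightarrow> j < n \<Longrightarrow> \<bar>x $ j\<bar> \<le> B"
    unfolding bdd_above_def by force
  then show thesis using assms by (intro that[of B]) (auto simp: integer_box_def)
qed

lemma midpoint_vec_integer_box:
  assumes "x \<in> integer_box n B" "y \<in> integer_box n B" "parity_class n x = parity_class n y"
  shows "midpoint_vec x y \<in> integer_box n B"
proof -
  have "\<bar>midpoint_vec x y $ j\<bar> \<le> B" if "j < n" for j
  proof -
    have "\<bar>x $ j\<bar> \<le> B" "\<bar>y $ j\<bar> \<le> B" using assms that by (auto simp: integer_box_def)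
    then have "\<bar>(x $ j + y $ j) / 2\<bar> \<le> B" by (simp add: abs_le_iff)
    then show ?thesis
      using assms that by (simp add: midpoint_vec_index[of _ n] integer_box_def integer_vecs_def)
  qed
  then show ?thesis using assms midpoint_vec_integer by (auto simp: integer_box_def)
qed

section \<open>The upper bound\<close>

text \<open>
  This is the parity count from the introduction. It needs only points on the boundary
  of their own row and strictly inside the other rows, with p and q the only strict solutions in the
  box. The strictness makes the midpoint of two distinct boundary points a strict solution.
\<close>

lemma card_le_by_parity:
  fixes z :: "'i \<Rightarrow> real vec"
  assumes finI: "finite I" and a: "\<And>i. i \<in> I \<Longrightarrow> a i \<in> carrier_vec n"
    and z: "\<And>i. i \<in> I \<Longrightarrow> z i \<in> integer_box n B"
    and p: "p \<in> integer_box n B" and q: "q \<in> integer_box n B" and pq: "p \<noteq> q"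
    and conv: "\<And>i j. i \<in> I \<Longrightarrow> j \<in> I \<Longrightarrow> i \<noteq> j \<Longrightarrow> a j \<bullet> z i < a j \<bullet> z j"
    and inner: "\<And>x. x \<in> integer_box n B \<Longrightarrow> (\<forall>i\<in>I. a i \<bullet> x < a i \<bullet> z i) \<longleftrightarrow> x = p \<or> x = q"
  shows "card I \<le> 2 * (2 ^ n - 1)"
proof -
  let ?par = "parity_class n" and ?F = "integer_box n B"
  have car: "x \<in> carrier_vec n" if "x \<in> ?F" for x
    using that by (simp add: integer_box_def integer_vecs_def)
  have pin: "\<forall>i\<in>I. a i \<bullet> p < a i \<bullet> z i" and qin: "\<forall>i\<in>I. a i \<bullet> q < a i \<bullet> z i"
    using inner p q by blast+
  have mid_inner: "midpoint_vec x y = p \<or> midpoint_vec x y = q"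
    if "x \<in> ?F" "y \<in> ?F" "?par x = ?par y" "\<forall>i\<in>I. a i \<bullet> x + a i \<bullet> y < 2 * (a i \<bullet> z i)" for x y
  proof -
    have "a i \<bullet> midpoint_vec x y < a i \<bullet> z i" if "i \<in> I" for i
      using scalar_prod_midpoint_vec[OF a[OF that] car[OF \<open>x \<in> ?F\<close>] car[OF \<open>y \<in> ?F\<close>]]
        \<open>\<forall>i\<in>I. a i \<bullet> x + a i \<bullet> y < 2 * (a i \<bullet> z i)\<close> that by fastforce
    then show ?thesis using inner midpoint_vec_integer_box that by blast
  qed
  have zz: "midpoint_vec (z i) (z j) = p \<or> midpoint_vec (z i) (z j) = q"
    if "i \<in> I" "j \<in> I" "i \<noteq> j" "?par (z i) = ?par (z j)" for i j
  proof (rule mid_inner)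
    show "\<forall>k\<in>I. a k \<bullet> z i + a k \<bullet> z j < 2 * (a k \<bullet> z k)"
      using conv that by (smt (verit))
  qed (use z that in auto)
  have zin: "z i \<noteq> z j" if "i \<in> I" "j \<in> I" "i \<noteq> j" for i j
    using conv[OF that] by auto
  define J where "J c = {i\<in>I. ?par (z i) = c}" for c
  have finJ: "finite (J c)" for c using finI by (simp add: J_def)
  have J2: "card (J c) \<le> 2" for c
  proof (rule ccontr)
    assume "\<not> card (J c) \<le> 2"
    then have "3 \<le> card (J c)" by simp
    then obtain D where "D \<subseteq> J c" "card D = 3" by (rule obtain_subset_with_card_n)
    then obtain i j k where ijk: "i \<in> J c" "j \<in> J c" "k \<in> J c" "i \<noteq> j" "i \<noteq> k" "j \<noteq> k"
      unfolding card_3_iff by auto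
    then have I: "i \<in> I" "j \<in> I" "k \<in> I"
      and par: "?par (z i) = ?par (z j)" "?par (z i) = ?par (z k)" "?par (z j) = ?par (z k)"
      by (auto simp: J_def)
    note C = car[OF z]
    have "midpoint_vec (z i) (z j) \<noteq> midpoint_vec (z i) (z k)"
      using midpoint_vec_cancel[of "z i" n] C I zin ijk by metis
    moreover have "midpoint_vec (z j) (z i) \<noteq> midpoint_vec (z j) (z k)"
      using midpoint_vec_cancel[of "z j" n] C I zin ijk by metis
    moreover have "midpoint_vec (z k) (z i) \<noteq> midpoint_vec (z k) (z j)"
      using midpoint_vec_cancel[of "z k" n] C I zin ijk by metis
    ultimately show False
      using zz[of i j] zz[of i k] zz[of j k] I par ijk midpoint_vec_commute[of _ n] C by metis
  qed
  \<comment> \<open>Here s is either of p and q, and t is the other one.\<close>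
  have J1: "card (J (?par s)) \<le> 1"
    if s: "s \<in> ?F" "\<forall>i\<in>I. a i \<bullet> s < a i \<bullet> z i" and t: "{s, t} = {p, q}" for s t
  proof -
    have mid: "midpoint_vec s (z i) = t" if "i \<in> J (?par s)" for i
    proof -
      have i: "i \<in> I" "?par s = ?par (z i)" using that by (auto simp: J_def)
      have "midpoint_vec s (z i) = p \<or> midpoint_vec s (z i) = q"
      proof (rule mid_inner)
        show "\<forall>k\<in>I. a k \<bullet> s + a k \<bullet> z i < 2 * (a k \<bullet> z k)"
          using conv s i by (smt (verit))
      qed (use z i s in auto)
      moreover have "midpoint_vec s (z i) \<noteq> s"
        using midpoint_vec_cancel[of s n "z i" s] midpoint_vec_same[of s n] car z i s
        by force
      ultimately show ?thesis using t by (auto simp: doubleton_eq_iff)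
    qed
    have "i = j" if "i \<in> J (?par s)" "j \<in> J (?par s)" for i j
    proof -
      have I: "i \<in> I" "j \<in> I" using that by (auto simp: J_def)
      have "z i = z j" using midpoint_vec_cancel[of s n] mid that car z I s by metis
      then show ?thesis using zin I by blast
    qed
    then show ?thesis using finJ by (auto simp: card_le_Suc0_iff_eq)
  qed
  have par_pq: "?par p \<noteq> ?par q"
  proof
    assume "?par p = ?par q"
    moreover have "\<forall>i\<in>I. a i \<bullet> p + a i \<bullet> q < 2 * (a i \<bullet> z i)"
    proof
      fix i assume "i \<in> I"
      then show "a i \<bullet> p + a i \<bullet> q < 2 * (a i \<bullet> z i)" using bspec[OF pin] bspec[OF qin] by fastforce
    qed
    ultimately have "midpoint_vec p q = p \<or> midpoint_vec p q = q" using mid_inner[OF p q] by blast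
    then have "midpoint_vec p q = midpoint_vec p p \<or> midpoint_vec q p = midpoint_vec q q"
      using midpoint_vec_same[OF car[OF p]] midpoint_vec_same[OF car[OF q]]
        midpoint_vec_commute[OF car[OF p] car[OF q]] by auto
    then show False
      using midpoint_vec_cancel[OF car[OF p] car[OF q] car[OF p]]
        midpoint_vec_cancel[OF car[OF q] car[OF p] car[OF q]] pq by auto
  qed
  let ?P = "Pow {..<n}"
  have sub: "{?par p, ?par q} \<subseteq> ?P" by (auto simp: parity_class_def)
  have cardP: "card ?P = 2 ^ n" by (simp add: card_Pow)
  have cardd: "card (?P - {?par p, ?par q}) = 2 ^ n - 2"
    using card_Diff_subset[OF _ sub] par_pq cardP by simp
  have "card {?par p, ?par q} \<le> card ?P" using sub by (intro card_mono) auto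
  then have ge: "2 \<le> (2::nat) ^ n" using par_pq cardP by simp
  have "i \<in> (\<Union>c\<in>?P. J c)" if "i \<in> I" for i
    by (rule UN_I[of "?par (z i)"]) (use that in \<open>auto simp: J_def parity_class_def\<close>)
  then have "card I \<le> card (\<Union>c\<in>?P. J c)" using finJ by (intro card_mono) auto
  also have "\<dots> \<le> (\<Sum>c\<in>?P. card (J c))" by (rule card_UN_le) simp
  also have "\<dots> = (\<Sum>c\<in>?P - {?par p, ?par q}. card (J c)) + (\<Sum>c\<in>{?par p, ?par q}. card (J c))"
    using sub by (intro sum.subset_diff) auto
  also have "\<dots> \<le> (2 ^ n - 2) * 2 + 2"
  proof (rule add_mono)
    show "(\<Sum>c\<in>?P - {?par p, ?par q}. card (J c)) \<le> (2 ^ n - 2) * 2"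
      using sum_bounded_above[of "?P - {?par p, ?par q}" "\<lambda>c. card (J c)" 2] J2 cardd by simp
    show "(\<Sum>c\<in>{?par p, ?par q}. card (J c)) \<le> 2"
      using J1[OF p pin, of q] J1[OF q qin, of p] par_pq by (simp add: insert_commute)
  qed
  also have "\<dots> = 2 * (2 ^ n - 1)" using ge by (simp add: diff_mult_distrib2)
  finally show ?thesis .
qed

lemma suffices_two: "suffices n 2 (2 * (2 ^ n - 1))"
  unfolding suffices_def
proof (intro allI ballI impI)
  fix m and A :: "real mat" and b :: "real vec"
  assume A: "A \<in> carrier_mat m n" and b: "b \<in> carrier_vec m"
    and "finite (integer_points (polyhedron A b)) \<and> card (integer_points (polyhedron A b)) = 2"
  define S where "S I = {x \<in> integer_vecs n. \<forall>i\<in>I. row A i \<bullet> x \<le> b $ i}" for I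
  have full: "integer_points (polyhedron A b) = S {..<m}"
    using integer_points_polyhedron[OF A b] by (auto simp: S_def)
  then obtain p q where pq: "S {..<m} = {p, q}" "p \<noteq> q"
    using \<open>finite _ \<and> card _ = 2\<close> by (auto simp: card_2_iff)
  have "\<exists>I. (I \<subseteq> {..<m} \<and> S I = {p, q}) \<and>
      (\<forall>I'. I' \<subseteq> {..<m} \<and> S I' = {p, q} \<longrightarrow> card I \<le> card I')"
    by (rule ex_has_least_nat[where k = "{..<m}"]) (simp add: pq)
  then obtain I where I: "I \<subseteq> {..<m}" "S I = {p, q}"
    and mn: "\<And>I'. I' \<subseteq> {..<m} \<Longrightarrow> S I' = {p, q} \<Longrightarrow> card I \<le> card I'"
    by (elim exE conjE) simp
  have finI: "finite I" using I finite_subset by blast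
  have "\<exists>x. x \<in> integer_vecs n \<and> b $ i < row A i \<bullet> x \<and> (\<forall>j\<in>I - {i}. row A j \<bullet> x \<le> b $ j)"
    if i: "i \<in> I" for i
  proof -
    have "card (I - {i}) < card I" using i finI by (rule card_Diff1_less[rotated])
    then have "S (I - {i}) \<noteq> S I" using mn[of "I - {i}"] I by fastforce
    moreover have "S I \<subseteq> S (I - {i})" by (auto simp: S_def)
    ultimately obtain x where x: "x \<in> S (I - {i})" "x \<notin> S I" by blast
    then have x': "x \<in> integer_vecs n" "\<forall>j\<in>I - {i}. row A j \<bullet> x \<le> b $ j" by (auto simp: S_def)
    have "b $ i < row A i \<bullet> x"
    proof (rule ccontr)
      assume "\<not> b $ i < row A i \<bullet> x"
      then have "row A j \<bullet> x \<le> b $ j" if "j \<in> I" for j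
        using x'(2) that by (cases "j = i") auto
      then have "x \<in> S I" using x'(1) by (simp add: S_def)
      then show False using x(2) by contradiction
    qed
    then show ?thesis using x' by blast
  qed
  then obtain y where y: "\<And>i. i \<in> I \<Longrightarrow> y i \<in> integer_vecs n \<and> b $ i < row A i \<bullet> y i \<and>
      (\<forall>j\<in>I - {i}. row A j \<bullet> y i \<le> b $ j)" by metis
  have pq_int: "p \<in> integer_vecs n" "q \<in> integer_vecs n" using pq(1) by (auto simp: S_def)
  obtain B where B: "insert p (insert q (y ` I)) \<subseteq> integer_box n B"
    by (rule finite_subset_integer_box[of "insert p (insert q (y ` I))" n])
      (use finI y pq_int in auto)
  have "\<exists>x\<in>integer_box n B. b $ i < row A i \<bullet> x \<and> (\<forall>j\<in>I - {i}. row A j \<bullet> x \<le> b $ j)"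
    if "i \<in> I" for i using y[OF that] B that by blast
  then obtain z where z: "\<And>i. i \<in> I \<Longrightarrow> z i \<in> integer_box n B"
    "\<And>i. i \<in> I \<Longrightarrow> b $ i < row A i \<bullet> z i"
    "\<And>i j. i \<in> I \<Longrightarrow> j \<in> I \<Longrightarrow> i \<noteq> j \<Longrightarrow> row A j \<bullet> z i < row A j \<bullet> z j"
    "\<And>x. x \<in> integer_box n B \<Longrightarrow> \<forall>i\<in>I. row A i \<bullet> x < row A i \<bullet> z i \<Longrightarrow> \<forall>i\<in>I. row A i \<bullet> x \<le> b $ i"
    using push_out_constraints[OF finI finite_integer_box[of n B], of "\<lambda>i. b $ i" "\<lambda>i x. row A i \<bullet> x"]
    by blast
  have "card I \<le> 2 * (2 ^ n - 1)"
  proof (rule card_le_by_parity[where a = "row A" and z = z and B = B and p = p and q = q])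
    fix x assume x: "x \<in> integer_box n B"
    have "(\<forall>i\<in>I. row A i \<bullet> x < row A i \<bullet> z i) \<longleftrightarrow> x \<in> S I"
      using z(2) z(4)[OF x] x by (fastforce simp: S_def integer_box_def)
    then show "(\<forall>i\<in>I. row A i \<bullet> x < row A i \<bullet> z i) \<longleftrightarrow> x = p \<or> x = q"
      using I by auto
  qed (use finI A B pq z in auto)
  moreover have "integer_points (polyhedron (submatrix A I UNIV) (subvec b I)) = S I"
    unfolding integer_points_restrict[OF A b I(1)] S_def by (rule refl)
  ultimately show "\<exists>I\<subseteq>{..<m}. card I \<le> 2 * (2 ^ n - 1) \<and>
      integer_points (polyhedron (submatrix A I UNIV) (subvec b I)) = integer_points (polyhedron A b)"
    using I full pq by (intro exI[of _ I]) simp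
qed

section \<open>The lower bound\<close>

text \<open>
  A subsystem with fewer rows omits some row k, and then the point z k satisfies everything that is
  left, although it violates the full system.
\<close>

lemma card_le_if_suffices:
  fixes a :: "'k \<Rightarrow> real vec" and \<beta> :: "'k \<Rightarrow> real"
  assumes suff: "suffices n (card Z) t" and finK: "finite K"
    and a: "\<And>k. k \<in> K \<Longrightarrow> a k \<in> carrier_vec n"
    and z: "\<And>k. k \<in> K \<Longrightarrow> z k \<in> integer_vecs n"
    and Z: "Z = {x \<in> integer_vecs n. \<forall>k\<in>K. a k \<bullet> x \<le> \<beta> k}" and finZ: "finite Z"
    and cut: "\<And>k. k \<in> K \<Longrightarrow> \<beta> k < a k \<bullet> z k"
    and keep: "\<And>k l. k \<in> K \<Longrightarrow> l \<in> K \<Longrightarrow> k \<noteq> l \<Longrightarrow> a k \<bullet> z l \<le> \<beta> k"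
  shows "card K \<le> t"
proof -
  define N where "N = card K"
  obtain h where h: "bij_betw h {..<N} K"
    using ex_bij_betw_nat_finite[OF finK] by (auto simp: N_def atLeast0LessThan)
  have hK: "h i \<in> K" if "i < N" for i using h that by (auto simp: bij_betw_def)
  define A where "A = mat N n (\<lambda>(i, j). a (h i) $ j)"
  define b where "b = vec N (\<lambda>i. \<beta> (h i))"
  have A: "A \<in> carrier_mat N n" and b: "b \<in> carrier_vec N" by (auto simp: A_def b_def)
  have row: "row A i = a (h i)" if "i < N" for i
    using a[OF hK[OF that]] that by (intro eq_vecI) (auto simp: A_def)
  have full: "integer_points (polyhedron A b) = Z"
  proof -
    have "(\<forall>i<N. a (h i) \<bullet> x \<le> \<beta> (h i)) \<longleftrightarrow> (\<forall>k\<in>K. a k \<bullet> x \<le> \<beta> k)" for x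
      using h unfolding bij_betw_def by blast
    then show ?thesis unfolding integer_points_polyhedron[OF A b] Z by (simp add: row b_def)
  qed
  have "finite (integer_points (polyhedron A b)) \<and> card (integer_points (polyhedron A b)) = card Z"
    using full finZ by simp
  from suff[unfolded suffices_def, rule_format, OF A b this] obtain I where
    I: "I \<subseteq> {..<N}" "card I \<le> t" and
    "integer_points (polyhedron (submatrix A I UNIV) (subvec b I)) = integer_points (polyhedron A b)"
    by blast
  then have eq: "{x \<in> integer_vecs n. \<forall>i\<in>I. row A i \<bullet> x \<le> b $ i} = Z"
    using integer_points_restrict[OF A b I(1)] full by simp
  have "I = {..<N}"
  proof (rule ccontr)
    assume "I \<noteq> {..<N}"
    then obtain i where i: "i < N" "i \<notin> I" using I by blast
    have "row A j \<bullet> z (h i) \<le> b $ j" if "j \<in> I" for j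
    proof -
      have "j < N" "j \<noteq> i" using that I i by auto
      moreover have "h j \<noteq> h i" using h \<open>j < N\<close> i \<open>j \<noteq> i\<close> by (auto simp: bij_betw_def inj_on_def)
      ultimately show ?thesis using keep[of "h j" "h i"] hK i by (simp add: row b_def)
    qed
    then have "z (h i) \<in> Z" using z[OF hK[OF i(1)]] unfolding eq[symmetric] by blast
    then show False using cut[OF hK[OF i(1)]] hK[OF i(1)] unfolding Z by force
  qed
  then show ?thesis using I by (simp add: N_def)
qed

text \<open>
  The rows are indexed by the nonempty subsets T of the coordinates 0, ..., d. For T different from
  {d}, put S = T - {d} and let u and t denote the first d coordinates and the last coordinate of a
  point. On the first d coordinates the form gives weight d to the elements of S and weight -1 to
  the others; since d exceeds the number of elements outside a nonempty S, it attains its maximum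
  over the vectors of {0,1}^d and {0,-1}^d exactly at the indicator of S. This form is doubled,
  and t is added or subtracted: the factor 2 leaves room to distinguish the two points over S with
  t = 0 and t = 1 without disturbing the comparison between different sets S. For T = {d} the form
  is t itself.
\<close>

definition cut_coeff :: "nat \<Rightarrow> nat set \<Rightarrow> nat \<Rightarrow> int" where
  "cut_coeff d T j =
     (if T = {d} then of_bool (j = d)
      else if j = d then (if d \<in> T then 1 else - 1)
      else (if j \<in> T then 2 * int d else - 2))"

definition cut_form :: "nat \<Rightarrow> nat set \<Rightarrow> (nat \<Rightarrow> int) \<Rightarrow> int" where
  "cut_form d T x = (\<Sum>j<Suc d. cut_coeff d T j * x j)"

definition cut_rhs :: "nat \<Rightarrow> nat set \<Rightarrow> int" where
  "cut_rhs d T =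
     (if T = {d} then 1
      else 2 * (int d * int (card (T \<inter> {..<d}))) - (if d \<in> T then 0 else 1))"

definition cut_point :: "nat \<Rightarrow> nat set \<Rightarrow> nat \<Rightarrow> int" where
  "cut_point d T j = (if T = {d} then 2 * of_bool (j = d) else of_bool (j \<in> T))"

definition axis_point :: "nat \<Rightarrow> nat \<Rightarrow> int" where
  "axis_point d j = of_bool (j = d)"

text \<open>For T different from {d}, half of the part of the form that depends on the first d coordinates.\<close>
definition base_form :: "nat \<Rightarrow> nat set \<Rightarrow> (nat \<Rightarrow> int) \<Rightarrow> int" where
  "base_form d T u = (\<Sum>j<d. (if j \<in> T then int d else - 1) * u j)"

lemma base_form_cong: "(\<And>j. j < d \<Longrightarrow> u j = v j) \<Longrightarrow> base_form d T u = base_form d T v"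
  by (simp add: base_form_def)

lemma cut_form_axis: "cut_form d {d} x = x d"
  by (simp add: cut_form_def cut_coeff_def)

lemma cut_form_base:
  assumes "T \<noteq> {d}"
  shows "cut_form d T x = 2 * base_form d T x + (if d \<in> T then x d else - x d)"
proof -
  have "(\<Sum>j<d. cut_coeff d T j * x j) = 2 * base_form d T x"
    unfolding base_form_def sum_distrib_left
    by (rule sum.cong) (simp_all add: cut_coeff_def assms)
  then show ?thesis by (simp add: cut_form_def cut_coeff_def assms)
qed

lemma cut_form_diff: "cut_form d T (\<lambda>j. x j - y j) = cut_form d T x - cut_form d T y"
  by (simp add: cut_form_def right_diff_distrib sum_subtractf)

text \<open>
  Writing the maximum d |S| as a sum over all coordinates allows it to be compared with values of the
  form summand by summand.
\<close>

lemma int_mult_card: "int d * int (card (T \<inter> {..<d})) = (\<Sum>j<d. int d * of_bool (j \<in> T))"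
  by (simp add: sum_distrib_left[symmetric] Int_def conj_commute)

lemma base_form_indicator_same:
  "base_form d T (\<lambda>j. of_bool (j \<in> T)) = int d * int (card (T \<inter> {..<d}))"
  unfolding int_mult_card base_form_def by (intro sum.cong) auto

text \<open>
  No summand of the left side exceeds the corresponding one on the right, and a coordinate in which
  the two sets differ loses at least one: either weight d is missed or weight -1 is picked up.
\<close>

lemma base_form_indicator_less:
  assumes "T' \<inter> {..<d} \<noteq> T \<inter> {..<d}"
  shows "base_form d T (\<lambda>j. of_bool (j \<in> T')) < int d * int (card (T \<inter> {..<d}))"
  unfolding int_mult_card base_form_def
proof (rule sum_strict_mono_ex1)
  show "\<exists>j\<in>{..<d}. (if j \<in> T then int d else - 1) * of_bool (j \<in> T') < int d * of_bool (j \<in> T)"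
    using assms by (auto simp: set_eq_iff of_bool_def)
qed auto

text \<open>
  Only coordinates outside T can contribute positively, each at most one, and there are fewer than d
  of them, while d |S| is at least d.
\<close>

lemma base_form_neg_indicator_less:
  assumes "T \<inter> {..<d} \<noteq> {}"
  shows "- base_form d T (\<lambda>j. of_bool (j \<in> T')) < int d * int (card (T \<inter> {..<d}))"
proof -
  obtain i where i: "i \<in> T" "i < d" using assms by auto
  have "- base_form d T (\<lambda>j. of_bool (j \<in> T')) = (\<Sum>j<d. - ((if j \<in> T then int d else - 1) * of_bool (j \<in> T')))"
    by (simp add: base_form_def sum_negf)
  also have "\<dots> \<le> (\<Sum>j<d. of_bool (j \<noteq> i))"
    using i by (intro sum_mono) (auto simp: of_bool_def)
  also have "\<dots> = int (card ({..<d} - {i}))"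
    by (simp add: set_diff_eq Int_def)
  also have "\<dots> = int d - 1" using i by simp
  also have "\<dots> < int d * 1" by simp
  also have "\<dots> \<le> int d * int (card (T \<inter> {..<d}))"
    using assms by (intro mult_left_mono) (auto simp: Suc_le_eq card_gt_0_iff)
  finally show ?thesis .
qed

text \<open>
  This is what excludes all other integer vectors: if u has a positive entry, the form belonging to
  its set of positive entries is at least as large at u as at the indicator of that set, because
  positive integers are at least 1 and the nonpositive entries are weighted by -1.
\<close>

lemma base_form_positive_part:
  "int d * int (card ({j. 0 < u j} \<inter> {..<d})) \<le> base_form d {j. 0 < u j} u"
  unfolding int_mult_card base_form_def
proof (rule sum_mono)
  fix j
  have "int d * 1 \<le> int d * u j" if "0 < u j" using that by (intro mult_left_mono) auto
  then show "int d * of_bool (j \<in> {j. 0 < u j}) \<le> (if j \<in> {j. 0 < u j} then int d else - 1) * u j"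
    by auto
qed

lemma base_part_nonempty:
  assumes "T \<in> Pow {..<Suc d} - {{}}" "T \<noteq> {d}"
  shows "T \<inter> {..<d} \<noteq> {}"
proof
  assume "T \<inter> {..<d} = {}"
  then have "T \<subseteq> {d}" using assms by (auto simp: lessThan_Suc)
  then show False using assms by auto
qed

lemma int_mult_card_pos:
  assumes "T \<inter> {..<d} \<noteq> {}"
  shows "1 \<le> int d * int (card (T \<inter> {..<d}))"
proof -
  have "0 < d" using assms by auto
  moreover have "0 < card (T \<inter> {..<d})" using assms by (simp add: card_gt_0_iff)
  ultimately have "0 < int d * int (card (T \<inter> {..<d}))" by simp
  then show ?thesis by simp
qed

lemma cut_point_base:
  "T \<noteq> {d} \<Longrightarrow> base_form d S (cut_point d T) = base_form d S (\<lambda>j. of_bool (j \<in> T))"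
  "base_form d S (cut_point d {d}) = 0"
  by (simp_all add: base_form_def cut_point_def)

lemma cut_point_last: "cut_point d T d = (if T = {d} then 2 else of_bool (d \<in> T))"
  by (simp add: cut_point_def)

lemma cut_form_axis_point: "cut_form d T (axis_point d) = cut_coeff d T d"
  by (simp add: cut_form_def axis_point_def)

lemma cut_point_cut: "cut_rhs d T < cut_form d T (cut_point d T)"
proof (cases "T = {d}")
  case True
  then show ?thesis by (simp add: cut_form_axis cut_rhs_def cut_point_def)
next
  case False
  then show ?thesis
    by (simp add: cut_form_base cut_rhs_def cut_point_base cut_point_last base_form_indicator_same)
qed

text \<open>
  At a point over a different base set the doubled form falls short of its maximum by at least 2, and
  the last coordinate makes up for at most 1 of this. Over the same base set the two points differ in the last
  coordinate, whose sign in the form favours the point belonging to T. The point 2e lies over the zero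
  vector and can therefore be dealt with by the positivity of d |S|.
\<close>

lemma cut_point_kept:
  assumes T: "T \<in> Pow {..<Suc d} - {{}}" and T': "T' \<in> Pow {..<Suc d} - {{}}" and "T' \<noteq> T"
  shows "cut_form d T (cut_point d T') \<le> cut_rhs d T"
proof (cases "T = {d}")
  case True
  then show ?thesis using \<open>T' \<noteq> T\<close> by (simp add: cut_form_axis cut_rhs_def cut_point_def)
next
  case False
  note pos = int_mult_card_pos[OF base_part_nonempty[OF T False]]
  show ?thesis
  proof (cases "T' = {d}")
    case True
    then show ?thesis using False pos
      by (simp add: cut_form_base cut_rhs_def cut_point_base cut_point_last)
  next
    case F': False
    show ?thesis
    proof (cases "T' \<inter> {..<d} = T \<inter> {..<d}")
      case True
      have split: "S = (S \<inter> {..<d}) \<union> (if d \<in> S then {d} else {})" if "S \<subseteq> {..<Suc d}" for S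
        using that by (auto simp: lessThan_Suc)
      have "(d \<in> T) \<noteq> (d \<in> T')"
      proof
        assume d: "(d \<in> T) = (d \<in> T')"
        have "T' = (T' \<inter> {..<d}) \<union> (if d \<in> T' then {d} else {})" using T' by (intro split) simp
        also have "\<dots> = (T \<inter> {..<d}) \<union> (if d \<in> T then {d} else {})" by (simp only: True d)
        also have "\<dots> = T" using T by (intro split[symmetric]) simp
        finally show False using \<open>T' \<noteq> T\<close> by simp
      qed
      moreover have "base_form d T (\<lambda>j. of_bool (j \<in> T')) = base_form d T (\<lambda>j. of_bool (j \<in> T))"
        using True by (intro base_form_cong) (auto simp: set_eq_iff)
      ultimately show ?thesis using False F'
        by (auto simp: cut_form_base cut_rhs_def cut_point_base cut_point_last base_form_indicator_same)
    next
      case neq: False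
      show ?thesis using False F' base_form_indicator_less[OF neq]
        by (simp add: cut_form_base cut_rhs_def cut_point_base cut_point_last)
    qed
  qed
qed

lemma reflected_cut_point_kept:
  assumes T: "T \<in> Pow {..<Suc d} - {{}}"
  shows "cut_form d T (\<lambda>j. axis_point d j - cut_point d T' j) \<le> cut_rhs d T"
proof (cases "T = {d}")
  case True
  then show ?thesis by (simp add: cut_form_axis cut_rhs_def cut_point_def axis_point_def)
next
  case False
  note ne = base_part_nonempty[OF T False]
  show ?thesis
  proof (cases "T' = {d}")
    case True
    then show ?thesis using False int_mult_card_pos[OF ne]
      by (simp add: cut_form_diff cut_form_axis_point cut_coeff_def cut_form_base cut_rhs_def
          cut_point_base cut_point_last)
  next
    case F': False
    show ?thesis using False F' base_form_neg_indicator_less[OF ne, of T']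
      by (simp add: cut_form_diff cut_form_axis_point cut_coeff_def cut_form_base cut_rhs_def
          cut_point_base cut_point_last)
  qed
qed

lemma cuts_imp_nonpos:
  assumes cuts: "\<And>T. T \<in> Pow {..<Suc d} - {{}} \<Longrightarrow> cut_form d T x \<le> cut_rhs d T"
    and last: "x d = 0 \<or> x d = 1" and "j < d"
  shows "x j \<le> 0"
proof (rule ccontr)
  assume "\<not> x j \<le> 0"
  \<comment> \<open>The last coordinate of x decides which of the two cuts over the same base set is violated.\<close>
  define T where "T = {i. 0 < x i} \<inter> {..<Suc d}"
  have jT: "j \<in> T" using \<open>\<not> x j \<le> 0\<close> \<open>j < d\<close> by (simp add: T_def)
  then have T: "T \<in> Pow {..<Suc d} - {{}}" by (auto simp: T_def)
  have ne: "T \<noteq> {d}" using jT \<open>j < d\<close> by blast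
  have "T \<inter> {..<d} = {i. 0 < x i} \<inter> {..<d}" by (auto simp: T_def)
  moreover have "base_form d T x = base_form d {i. 0 < x i} x"
    unfolding base_form_def by (intro sum.cong) (auto simp: T_def)
  ultimately have "int d * int (card (T \<inter> {..<d})) \<le> base_form d T x"
    using base_form_positive_part[of d x] by simp
  moreover have "d \<in> T \<longleftrightarrow> x d = 1" using last by (auto simp: T_def)
  ultimately show False using cuts[OF T] ne last
    by (auto simp: cut_form_base cut_rhs_def split: if_splits)
qed

text \<open>
  The rows of {d} leave only 0 and 1 for the last coordinate. The rows then exclude
  positive entries among the other coordinates of x, and the reflected rows exclude negative ones.
\<close>

lemma solutions_of_cuts:
  "(\<forall>T\<in>Pow {..<Suc d} - {{}}. cut_form d T x \<le> cut_rhs d T \<and>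
      cut_form d T (\<lambda>j. axis_point d j - x j) \<le> cut_rhs d T) \<longleftrightarrow>
    (\<forall>j<d. x j = 0) \<and> (x d = 0 \<or> x d = 1)" (is "?L \<longleftrightarrow> ?R")
proof
  assume L: ?L
  have "x d \<le> 1" "0 \<le> x d"
    using L[rule_format, of "{d}"] by (auto simp: cut_form_axis cut_rhs_def axis_point_def)
  then have last: "x d = 0 \<or> x d = 1" by linarith
  have "x j \<le> 0" if "j < d" for j using cuts_imp_nonpos[of d x j] L last that by blast
  moreover have "0 \<le> x j" if "j < d" for j
  proof -
    have "axis_point d j - x j \<le> 0"
      using L last that
      by (intro cuts_imp_nonpos[of d "\<lambda>j. axis_point d j - x j" j]) (auto simp: axis_point_def)
    then show ?thesis using that by (simp add: axis_point_def)
  qed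
  ultimately show ?R using last by force
next
  assume R: ?R
  show ?L
  proof
    fix T assume T: "T \<in> Pow {..<Suc d} - {{}}"
    show "cut_form d T x \<le> cut_rhs d T \<and> cut_form d T (\<lambda>j. axis_point d j - x j) \<le> cut_rhs d T"
    proof (cases "T = {d}")
      case True
      then show ?thesis using R by (auto simp: cut_form_axis cut_rhs_def axis_point_def)
    next
      case False
      have "base_form d T x = 0" using R by (simp add: base_form_def)
      then show ?thesis using False R int_mult_card_pos[OF base_part_nonempty[OF T False]]
        by (auto simp: cut_form_diff cut_form_axis_point cut_coeff_def cut_form_base cut_rhs_def)
    qed
  qed
qed

definition int_vec :: "nat \<Rightarrow> (nat \<Rightarrow> int) \<Rightarrow> real vec" where
  "int_vec n x = vec n (\<lambda>j. of_int (x j))"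

lemma int_vec_integer [simp]: "int_vec n x \<in> integer_vecs n"
  by (simp add: int_vec_def integer_vecs_def)

lemma int_vec_carrier [simp]: "int_vec n x \<in> carrier_vec n"
  by (simp add: int_vec_def)

lemma integer_vecs_cases:
  assumes "v \<in> integer_vecs n"
  obtains x where "v = int_vec n x"
proof
  show "v = int_vec n (\<lambda>j. \<lfloor>v $ j\<rfloor>)"
    using assms by (intro eq_vecI) (auto simp: int_vec_def integer_vecs_def elim!: Ints_cases)
qed

lemma scalar_prod_int_vec: "int_vec n a \<bullet> int_vec n x = of_int (\<Sum>j<n. a j * x j)"
  by (simp add: int_vec_def scalar_prod_def atLeast0LessThan)

lemma int_vec_eq_iff: "int_vec n x = int_vec n y \<longleftrightarrow> (\<forall>j<n. x j = y j)"
  by (auto simp: int_vec_def vec_eq_iff)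

lemma suffices_two_lower:
  assumes suff: "suffices (Suc d) 2 t"
  shows "2 * (2 ^ Suc d - 1) \<le> t"
proof -
  let ?n = "Suc d"
  define \<T> where "\<T> = Pow {..<?n} - {{}}"
  \<comment> \<open>The sign tells the rows and points of the first half from their reflections.\<close>
  define K :: "(bool \<times> nat set) set" where "K = UNIV \<times> \<T>"
  define a where "a = (\<lambda>(s, T). int_vec ?n (\<lambda>j. if s then cut_coeff d T j else - cut_coeff d T j))"
  define \<beta> :: "bool \<times> nat set \<Rightarrow> real" where
    "\<beta> = (\<lambda>(s, T). of_int (if s then cut_rhs d T else cut_rhs d T - cut_form d T (axis_point d)))"
  define z where "z = (\<lambda>(s, T). int_vec ?n
    (if s then cut_point d T else (\<lambda>j. axis_point d j - cut_point d T j)))"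
  define Z where "Z = {int_vec ?n (\<lambda>_. 0), int_vec ?n (axis_point d)}"
  have a_pos: "a (True, T) \<bullet> int_vec ?n x = of_int (cut_form d T x)" for T x
    unfolding a_def by (simp only: case_prod_conv scalar_prod_int_vec if_True cut_form_def)
  have a_neg: "a (False, T) \<bullet> int_vec ?n x = of_int (- cut_form d T x)" for T x
    unfolding a_def
    by (simp only: case_prod_conv scalar_prod_int_vec if_False cut_form_def mult_minus_left sum_negf)
  have row_pos: "a (True, T) \<bullet> int_vec ?n x \<le> \<beta> (True, T) \<longleftrightarrow> cut_form d T x \<le> cut_rhs d T" for T x
    by (simp add: a_pos \<beta>_def)
  have row_neg: "a (False, T) \<bullet> int_vec ?n x \<le> \<beta> (False, T) \<longleftrightarrow>
      cut_form d T (\<lambda>j. axis_point d j - x j) \<le> cut_rhs d T" for T x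
  proof -
    have "a (False, T) \<bullet> int_vec ?n x \<le> \<beta> (False, T) \<longleftrightarrow>
        - cut_form d T x \<le> cut_rhs d T - cut_form d T (axis_point d)"
      unfolding a_neg \<beta>_def by (simp only: case_prod_conv if_False of_int_le_iff)
    then show ?thesis by (auto simp: cut_form_diff)
  qed
  have z_pos: "z (True, T) = int_vec ?n (cut_point d T)" for T by (simp add: z_def)
  have z_neg: "z (False, T) = int_vec ?n (\<lambda>j. axis_point d j - cut_point d T j)" for T
    by (simp add: z_def)
  have reflect: "(\<lambda>j. axis_point d j - (axis_point d j - y j)) = y" for y by auto
  have K_split: "K = Pair True ` \<T> \<union> Pair False ` \<T>" by (auto simp: K_def UNIV_bool)
  have Z_eq: "Z = {x \<in> integer_vecs ?n. \<forall>k\<in>K. a k \<bullet> x \<le> \<beta> k}"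
  proof -
    have sol: "(\<forall>k\<in>K. a k \<bullet> int_vec ?n x \<le> \<beta> k) \<longleftrightarrow> int_vec ?n x \<in> Z" for x
    proof -
      have "(\<forall>k\<in>K. a k \<bullet> int_vec ?n x \<le> \<beta> k) \<longleftrightarrow> (\<forall>T\<in>\<T>. cut_form d T x \<le> cut_rhs d T \<and>
          cut_form d T (\<lambda>j. axis_point d j - x j) \<le> cut_rhs d T)"
        by (simp only: K_split ball_Un ball_simps row_pos row_neg ball_conj_distrib)
      also have "\<dots> \<longleftrightarrow> int_vec ?n x \<in> Z"
        unfolding \<T>_def solutions_of_cuts Z_def
        by (auto simp: int_vec_eq_iff axis_point_def less_Suc_eq)
      finally show ?thesis .
    qed
    have "Z \<subseteq> integer_vecs ?n" by (auto simp: Z_def)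
    moreover have "v \<in> Z \<longleftrightarrow> (\<forall>k\<in>K. a k \<bullet> v \<le> \<beta> k)" if "v \<in> integer_vecs ?n" for v
      using integer_vecs_cases[OF that] sol by metis
    ultimately show ?thesis by blast
  qed
  have cardZ: "card Z = 2"
    by (auto simp: Z_def int_vec_eq_iff axis_point_def)
  have cardK: "card K = 2 * (2 ^ ?n - 1)"
    by (simp add: K_def \<T>_def card_cartesian_product card_Diff_subset card_Pow del: power_Suc)
  have "card K \<le> t"
  proof (rule card_le_if_suffices[where a = a and \<beta> = \<beta> and z = z and K = K and Z = Z])
    show "suffices ?n (card Z) t" using suff cardZ by simp
    show "finite K" by (simp add: K_def \<T>_def)
    show "finite Z" by (simp add: Z_def)
    show "a k \<in> carrier_vec ?n" "z k \<in> integer_vecs ?n" for k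
      by (simp_all add: a_def z_def split: prod.split)
    show "\<beta> k < a k \<bullet> z k" if "k \<in> K" for k
    proof (cases k)
      case (Pair s T)
      have "\<not> a (True, T) \<bullet> z (True, T) \<le> \<beta> (True, T)"
        unfolding z_pos row_pos using cut_point_cut[of d T] by simp
      moreover have "\<not> a (False, T) \<bullet> z (False, T) \<le> \<beta> (False, T)"
        unfolding z_neg row_neg reflect using cut_point_cut[of d T] by simp
      ultimately show ?thesis unfolding Pair by (cases s) simp_all
    qed
    show "a k \<bullet> z l \<le> \<beta> k" if k: "k \<in> K" and l: "l \<in> K" and "k \<noteq> l" for k l
    proof -
      obtain s T s' T' where kl: "k = (s, T)" "l = (s', T')" by fastforce
      have T: "T \<in> Pow {..<?n} - {{}}" "T' \<in> Pow {..<?n} - {{}}"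
        using k l unfolding kl K_def \<T>_def by auto
      have "a (True, T) \<bullet> z (True, T') \<le> \<beta> (True, T)" if "T' \<noteq> T"
        unfolding z_pos row_pos by (rule cut_point_kept[OF T that])
      moreover have "a (False, T) \<bullet> z (False, T') \<le> \<beta> (False, T)" if "T' \<noteq> T"
        unfolding z_neg row_neg reflect by (rule cut_point_kept[OF T that])
      moreover have "a (True, T) \<bullet> z (False, T') \<le> \<beta> (True, T)"
        unfolding z_neg row_pos by (rule reflected_cut_point_kept[OF T(1)])
      moreover have "a (False, T) \<bullet> z (True, T') \<le> \<beta> (False, T)"
        unfolding z_pos row_neg by (rule reflected_cut_point_kept[OF T(1)])
      ultimately show ?thesis using \<open>k \<noteq> l\<close> unfolding kl by (cases s; cases s') simp_all
    qed
  qed (rule Z_eq)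
  then show ?thesis using cardK by simp
qed

theorem proposition4p5:
  fixes n :: nat
  assumes "n \<ge> 1"
  shows "doignon_number n 2 = 2 * (2 ^ n - 1)"
  unfolding doignon_number_def
proof (rule Least_equality)
  show "suffices n 2 (2 * (2 ^ n - 1))" by (rule suffices_two)
  show "2 * (2 ^ n - 1) \<le> t" if "suffices n 2 t" for t
    using suffices_two_lower[of "n - 1" t] that assms by simp
qed

end
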